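(* Fix $m>0$, $\bar b>0$ with $\bar b\ne 3\sqrt2/2$, and $f\in\mathcal F_{m,L}$ with $L>m$; let $x^\star$ be the minimizer of $f$. If $\xi(t)=[v(t)^{T},x(t)^{T}]^{T}\in\mathbb R^{2d}$ is the solution of $$\dot v(t)=-\bar b\sqrt m\,v(t)-\frac1{\sqrt m}\nabla f(x(t)),\qquad \dot x(t)=\sqrt m\,v(t),\qquad t\ge0,$$ with initial condition $\xi_0=[v_0^{T},x_0^{T}]^{T}$, then, with $\xi^\star=[0^{T},(x^\star)^{T}]^{T}$, for all $t\ge0$, $$\|x(t)-x^\star\|^2\le C\,e^{-\bar r\sqrt m\,t}\Big(f(x_0)-f(x^\star)+\|\xi_0-\xi^\star\|_{\tilde P}^2\Big),$$ where $$\tilde P=\frac m2\begin{bmatrix}1&\bar r\\ \bar r&\frac{\bar r^2}{2}+1\end{bmatrix}\otimes I_d,\qquad C=\frac1{\lambda_{\min}(\tilde P)}=\frac{8}{m\big(\bar r^2+4-\bar r\sqrt{\bar r^2+16}\big)},$$ and $$\bar r=\begin{cases}\dfrac{2\bar b}{3},&\bar b<\dfrac{3\sqrt2}{2},\\[2mm] \bar b-\sqrt{\bar b^2-4},&\bar b>\dfrac{3\sqrt2}{2}.\end{cases}$$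
   Context: For $0<m\le L$, $\mathcal F_{m,L}$ denotes the set of differentiable functions $f:\mathbb R^d\to\mathbb R$ that are $m$-strongly convex and have $L$-Lipschitz gradient. $I_d$ is the $d\times d$ identity, $\otimes$ is the Kronecker product, $\|\cdot\|$ is the Euclidean norm, $\|w\|_{\tilde P}^2:=w^{T}\tilde Pw$, and $\lambda_{\min}(\cdot)$ denotes the smallest eigenvalue of a symmetric matrix. The system is the first-order form, with $v=\dot x/\sqrt m$, of Polyak's equation $\ddot x+\bar b\sqrt m\,\dot x+\nabla f(x)=0$. *)

theory Defs
  imports "HOL-Analysis.Analysis"
begin

text \<open>The value is only meaningful at points where \<open>f\<close> is differentiable.\<close>

definition grad :: "('a::real_inner \<Rightarrow> real) \<Rightarrow> 'a \<Rightarrow> 'a" where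
  "grad f x = (THE g. GDERIV f x :> g)"

definition strongly_convex :: "real \<Rightarrow> ('a::real_inner \<Rightarrow> real) \<Rightarrow> bool" where
  "strongly_convex m f \<longleftrightarrow>
     (\<forall>x y. \<forall>t\<in>{0..1}. f (t *\<^sub>R x + (1 - t) *\<^sub>R y)
        \<le> t * f x + (1 - t) * f y - m / 2 * t * (1 - t) * (norm (x - y))\<^sup>2)"

definition strongly_convex_smooth :: "real \<Rightarrow> real \<Rightarrow> ('a::real_inner \<Rightarrow> real) set" where
  "strongly_convex_smooth m L =
     {f. (\<forall>x. f differentiable (at x)) \<and> strongly_convex m f \<and> L-lipschitz_on UNIV (grad f)}"

text \<open>Block vectors and matrices are indexed by pairs (block, position inside the block), so
  \<open>2 \<times> 'd\<close> is the index type of \<open>2d\<close>-dimensional space.\<close>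

definition kronecker ::
  "real^'n^'m \<Rightarrow> real^'q^'p \<Rightarrow> real^('n::finite \<times> 'q::finite)^('m::finite \<times> 'p::finite)" where
  "kronecker A B = (\<chi> i j. A $ fst i $ fst j * B $ snd i $ snd j)"

definition stack :: "real^'d \<Rightarrow> real^'d \<Rightarrow> real^(2 \<times> 'd::finite)" where
  "stack v x = (\<chi> i. if fst i = 1 then v $ snd i else x $ snd i)"

definition sq_norm_wrt :: "real^'n^'n \<Rightarrow> real^'n \<Rightarrow> real" where
  "sq_norm_wrt P w = w \<bullet> (P *v w)"

text \<open>Every symmetric real matrix has a finite nonempty set of eigenvalues, so the least
  element exists for such matrices; for other matrices the value may be unspecified.\<close>

definition lambda_min :: "real^'n^'n \<Rightarrow> real" where
  "lambda_min A = (LEAST \<mu>. \<exists>w. w \<noteq> 0 \<and> A *v w = \<mu> *\<^sub>R w)"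

text \<open>The boundary value \<open>b = 3 * sqrt 2 / 2\<close> is excluded by the hypotheses; there the two branches agree.\<close>

definition rbar :: "real \<Rightarrow> real" where
  "rbar b = (if b < 3 * sqrt 2 / 2 then 2 * b / 3 else b - sqrt (b\<^sup>2 - 4))"

definition Ptilde :: "real \<Rightarrow> real \<Rightarrow> real^(2 \<times> 'd::finite)^(2 \<times> 'd)" where
  "Ptilde m r =
     kronecker ((m / 2) *\<^sub>R vector [vector [1, r], vector [r, r\<^sup>2 / 2 + 1]] :: real^2^2)
               (mat 1 :: real^'d^'d)"

end

theory Submission
  imports Defs
begin

text \<open>
  Write \<open>e = x - xs\<close>. The proof rests on the Lyapunov function
  \[V = f(x) - f(xs) + \frac m2 \bigl(|v|^2 + 2 r \langle v, e\rangle + \frac{r^2}{2} |e|^2\bigr)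
     = f(x) - f(xs) + \frac m2 \bigl(|v + r e|^2 - \frac{r^2}{2} |e|^2\bigr).\]
  Its quadratic part is \<open>Ptilde\<close> with the summand 1 removed from the lower right entry. Keeping
  that summand would add a multiple of \<open>\<langle>v, e\<rangle>\<close> to the estimate below which nothing can absorb
  when \<open>3 r = 2 b\<close>. When \<open>V\<close> is differentiated along the flow, the gradient terms paired with
  \<open>v\<close> cancel, and those paired with \<open>e\<close> are controlled by strong convexity at \<open>x\<close>
  (\<open>strongly_convex_gradient_bound\<close>). What is left of \<open>V' + r sqrt m V\<close> is a quadratic form
  in \<open>v\<close> and \<open>e\<close>, which after completing the square is
  \[-\bigl(b - \frac{3r}2\bigr) \bigl|v + \frac r2 e\bigr|^2
     - \frac r8 (r^2 - 2 b r + 4) |e|^2\]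
  up to the factor \<open>m sqrt m\<close>. So \<open>V\<close> decays at rate \<open>r sqrt m\<close> for every \<open>r \<ge> 0\<close> with
  \<open>3 r \<le> 2 b\<close> and \<open>r\<^sup>2 - 2 b r + 4 \<ge> 0\<close> (\<open>lyapunov_decay\<close>). The two branches of \<open>rbar\<close>
  are the values of \<open>r\<close> at which the first and the second of these constraints is an equality
  (\<open>rbar_properties\<close>).

  The missing summand 1 is worth \<open>m/2 |e|\<^sup>2\<close> in the weighted norm. At time \<open>t\<close> it is paid for by
  the quadratic growth of \<open>f\<close> around its minimizer, so that \<open>V\<close> dominates the \<open>Ptilde\<close>-norm of
  the state; at time 0 it only enlarges the right-hand side. Passing from the \<open>Ptilde\<close>-norm to
  \<open>|e|\<^sup>2\<close> costs the factor \<open>1 / lambda_min\<close>, which is positive because \<open>r\<^sup>2 < 2\<close> away from the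
  boundary value of \<open>b\<close>.
\<close>

section \<open>Gradients of strongly convex functions\<close>

lemma GDERIV_unique:
  assumes "GDERIV f x :> g" and "GDERIV f x :> h"
  shows "g = h"
proof -
  have "(\<lambda>k. k \<bullet> g) = (\<lambda>k. k \<bullet> h)"
    using assms unfolding gderiv_def by (rule has_derivative_unique)
  then have "\<forall>k. k \<bullet> g = k \<bullet> h"
    by (simp add: fun_eq_iff)
  then show ?thesis
    by (simp only: vector_eq_ldot)
qed

lemma GDERIV_grad:
  fixes f :: "'a::euclidean_space \<Rightarrow> real"
  assumes "f differentiable (at x)"
  shows "GDERIV f x :> grad f x"
proof -
  obtain f' where f': "(f has_derivative f') (at x)"
    using assms by (auto simp: differentiable_def)
  then have "linear f'"
    by (rule has_derivative_linear)
  then have "f' = (\<lambda>h. h \<bullet> adjoint f' 1)"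
    by (simp add: adjoint_works)
  then have "GDERIV f x :> adjoint f' 1"
    using f' by (simp add: gderiv_def)
  then show ?thesis
    unfolding grad_def by (rule theI) (rule GDERIV_unique[OF _ \<open>GDERIV f x :> adjoint f' 1\<close>])
qed

text \<open>On the segment from \<open>x\<close> to \<open>y\<close>, strong convexity bounds the difference quotient of \<open>f\<close>
  from above by a quantity that is affine in the segment parameter; the claim is the limit at the
  endpoint \<open>x\<close>.\<close>

lemma strongly_convex_gradient_bound:
  assumes sc: "strongly_convex m f" and g: "GDERIV f x :> g"
  shows "f x + g \<bullet> (y - x) + m / 2 * (norm (y - x))\<^sup>2 \<le> f y"
proof -
  define h where "h t = f (x + t *\<^sub>R (y - x))" for t :: real
  have "((\<lambda>t. x + t *\<^sub>R (y - x)) has_derivative (\<lambda>t. t *\<^sub>R (y - x))) (at 0)"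
    by (auto intro!: derivative_eq_intros)
  from has_derivative_compose[OF this, of f "\<lambda>k. k \<bullet> g"] g
  have "(h has_real_derivative g \<bullet> (y - x)) (at 0)"
    by (auto simp: h_def[abs_def] gderiv_def has_field_derivative_def inner_commute mult.commute
        elim!: has_derivative_eq_rhs)
  then have "((\<lambda>t. (h t - h 0) / t) \<longlongrightarrow> g \<bullet> (y - x)) (at 0)"
    by (simp add: has_field_derivative_iff)
  then have lim: "((\<lambda>t. (h t - h 0) / t) \<longlongrightarrow> g \<bullet> (y - x)) (at_right 0)"
    by (rule filterlim_mono) (auto simp: at_le)
  have bound: "(h t - h 0) / t \<le> f y - f x - m / 2 * (1 - t) * (norm (y - x))\<^sup>2"
    if "0 < t" "t < 1" for t
  proof -
    have "f (t *\<^sub>R y + (1 - t) *\<^sub>R x)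
        \<le> t * f y + (1 - t) * f x - m / 2 * t * (1 - t) * (norm (y - x))\<^sup>2"
      using sc that unfolding strongly_convex_def by auto
    moreover have "t *\<^sub>R y + (1 - t) *\<^sub>R x = x + t *\<^sub>R (y - x)"
      by (simp add: algebra_simps)
    ultimately have "h t - h 0 \<le> (f y - f x - m / 2 * (1 - t) * (norm (y - x))\<^sup>2) * t"
      by (simp add: h_def algebra_simps)
    then show ?thesis
      using that by (simp add: pos_divide_le_eq)
  qed
  have "((\<lambda>t. f y - f x - m / 2 * (1 - t) * (norm (y - x))\<^sup>2)
          \<longlongrightarrow> f y - f x - m / 2 * (1 - 0) * (norm (y - x))\<^sup>2) (at_right 0)"
    by (intro tendsto_intros)
  moreover have "\<forall>\<^sub>F t in at_right 0. (h t - h 0) / t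
      \<le> f y - f x - m / 2 * (1 - t) * (norm (y - x))\<^sup>2"
    using bound by (auto simp: eventually_at_right[of 0 1] intro!: exI[of _ 1])
  ultimately have "g \<bullet> (y - x) \<le> f y - f x - m / 2 * (1 - 0) * (norm (y - x))\<^sup>2"
    using lim by (intro tendsto_le[of "at_right 0"]) auto
  then show ?thesis
    by simp
qed

lemma strongly_convex_quadratic_growth:
  assumes "strongly_convex m f" and g: "GDERIV f xs :> g" and min: "\<And>y. f xs \<le> f y"
  shows "m / 2 * (norm (y - xs))\<^sup>2 \<le> f y - f xs"
proof -
  have "(\<lambda>k. k \<bullet> g) = (\<lambda>k. 0)"
    using g min unfolding gderiv_def by (intro differential_zero_maxmin[of xs UNIV f]) auto
  then have "g \<bullet> (y - xs) = 0"
    by (metis inner_commute)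
  then show ?thesis
    using strongly_convex_gradient_bound[OF assms(1) g, of y] by simp
qed

section \<open>Decay of the Lyapunov function\<close>

definition lyapunov :: "real \<Rightarrow> real \<Rightarrow> ('a::real_inner \<Rightarrow> real) \<Rightarrow> 'a \<Rightarrow> 'a \<Rightarrow> 'a \<Rightarrow> real" where
  "lyapunov m r f xs v x =
     f x - f xs + m / 2 * (v \<bullet> v + 2 * r * (v \<bullet> (x - xs)) + r\<^sup>2 / 2 * ((x - xs) \<bullet> (x - xs)))"

text \<open>The form below is \<open>(V' + r sqrt m V) / (m sqrt m)\<close> after the strong convexity bound has been
  used. Completing the square around \<open>v + (r/2) e\<close> separates the two constraints on \<open>r\<close>: each
  is the sign of one coefficient.\<close>

lemma dissipation_nonpos:
  fixes v e :: "'a::real_inner"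
  assumes "0 \<le> r" and "3 * r \<le> 2 * b" and "0 \<le> r\<^sup>2 - 2 * b * r + 4"
  shows "(3 * r / 2 - b) * (v \<bullet> v) + (3 * r\<^sup>2 / 2 - b * r) * (v \<bullet> e)
           + r / 2 * (r\<^sup>2 / 2 - 1) * (e \<bullet> e) \<le> 0" (is "?q \<le> 0")
proof -
  define w where "w = v + (r / 2) *\<^sub>R e"
  have w: "w \<bullet> w = v \<bullet> v + r * (v \<bullet> e) + r\<^sup>2 / 4 * (e \<bullet> e)"
    by (simp add: w_def inner_add_left inner_add_right inner_commute power2_eq_square)
  have "?q = - ((b - 3 * r / 2) * (w \<bullet> w)) - r / 8 * (r\<^sup>2 - 2 * b * r + 4) * (e \<bullet> e)"
    unfolding w by (simp add: field_simps power2_eq_square)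
  moreover have "0 \<le> (b - 3 * r / 2) * (w \<bullet> w)"
    using assms by (intro mult_nonneg_nonneg) auto
  moreover have "0 \<le> r / 8 * (r\<^sup>2 - 2 * b * r + 4) * (e \<bullet> e)"
    using assms by (intro mult_nonneg_nonneg) auto
  ultimately show ?thesis
    by linarith
qed

text \<open>The derivative of \<open>exp (r sqrt m t) V(t)\<close> is nonpositive by the preceding bound, so this
  function is nonincreasing. Only one-sided differentiability is available at time 0, hence
  monotonicity is derived from continuity on the closed interval and derivatives in its
  interior.\<close>

lemma lyapunov_decay:
  fixes f :: "'a::real_inner \<Rightarrow> real"
  assumes m: "0 < m"
    and r: "0 \<le> r" "3 * r \<le> 2 * b" "0 \<le> r\<^sup>2 - 2 * b * r + 4"
    and sc: "strongly_convex m f"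
    and G: "\<And>y. GDERIV f y :> G y"
    and v_ode: "\<And>t. 0 \<le> t \<Longrightarrow>
      (v has_vector_derivative
         (- (b * sqrt m)) *\<^sub>R v t - (1 / sqrt m) *\<^sub>R G (x t)) (at t within {0..})"
    and x_ode: "\<And>t. 0 \<le> t \<Longrightarrow>
      (x has_vector_derivative sqrt m *\<^sub>R v t) (at t within {0..})"
    and "0 \<le> T"
  shows "lyapunov m r f xs (v T) (x T)
           \<le> exp (- r * sqrt m * T) * lyapunov m r f xs (v 0) (x 0)"
proof -
  define V where "V t = lyapunov m r f xs (v t) (x t)" for t
  define e where "e t = x t - xs" for t
  define V' where "V' t = sqrt m * (m * ((r - b) * (v t \<bullet> v t)
      + (r\<^sup>2 / 2 - b * r) * (v t \<bullet> e t)) - r * (G (x t) \<bullet> e t))" for t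
  define W where "W t = exp (r * sqrt m * t) * V t" for t
  have sm: "m / sqrt m = sqrt m"
    using m by (simp add: real_div_sqrt)
  note inner_deriv = bounded_bilinear.has_vector_derivative[OF bounded_bilinear_inner]
  have dV: "(V has_real_derivative V' t) (at t within {0..})" if t: "0 \<le> t" for t
  proof -
    let ?dv = "(- (b * sqrt m)) *\<^sub>R v t - (1 / sqrt m) *\<^sub>R G (x t)"
    let ?de = "sqrt m *\<^sub>R v t"
    have de: "(e has_vector_derivative ?de) (at t within {0..})"
      unfolding e_def using x_ode[OF t] by (auto intro!: derivative_eq_intros)
    have df: "((\<lambda>t. f (x t)) has_real_derivative sqrt m * (G (x t) \<bullet> v t)) (at t within {0..})"
      using has_derivative_compose[OF x_ode[OF t, unfolded has_vector_derivative_def]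
          G[of "x t", unfolded gderiv_def]]
      by (auto simp: has_field_derivative_def inner_commute mult_ac elim!: has_derivative_eq_rhs)
    have dvv: "((\<lambda>t. v t \<bullet> v t) has_real_derivative v t \<bullet> ?dv + ?dv \<bullet> v t) (at t within {0..})"
      using inner_deriv[OF v_ode[OF t] v_ode[OF t]]
      by (simp add: has_real_derivative_iff_has_vector_derivative)
    have dve: "((\<lambda>t. v t \<bullet> e t) has_real_derivative v t \<bullet> ?de + ?dv \<bullet> e t) (at t within {0..})"
      using inner_deriv[OF v_ode[OF t] de]
      by (simp add: has_real_derivative_iff_has_vector_derivative)
    have dee: "((\<lambda>t. e t \<bullet> e t) has_real_derivative e t \<bullet> ?de + ?de \<bullet> e t) (at t within {0..})"
      using inner_deriv[OF de de]
      by (simp add: has_real_derivative_iff_has_vector_derivative)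
    have "((\<lambda>t. f (x t) - f xs + m / 2 * (v t \<bullet> v t + 2 * r * (v t \<bullet> e t) + r\<^sup>2 / 2 * (e t \<bullet> e t)))
        has_real_derivative sqrt m * (G (x t) \<bullet> v t) + m / 2 * ((v t \<bullet> ?dv + ?dv \<bullet> v t)
          + 2 * r * (v t \<bullet> ?de + ?dv \<bullet> e t) + r\<^sup>2 / 2 * (e t \<bullet> ?de + ?de \<bullet> e t))) (at t within {0..})"
      (is "(_ has_real_derivative ?D) _")
      by (rule derivative_eq_intros df dvv dve dee refl | simp)+
    moreover have "?D = V' t"
    proof -
      \<comment> \<open>With \<open>\<sigma> = sqrt m\<close> and \<open>k = 1 / sqrt m\<close> \<open>m k = \<sigma>\<close>, so the two terms in
          \<open>d = G(x) \<bullet> v\<close> on the right cancel: the potential energy lost is the kinetic energy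
          gained.\<close>
      have poly: "\<sigma> * d + m / 2 * ((- b * \<sigma> * p - k * d) + (- b * \<sigma> * p - k * d)
            + 2 * r * (\<sigma> * p + (- b * \<sigma> * q - k * c)) + r\<^sup>2 / 2 * (\<sigma> * q + \<sigma> * q))
          = \<sigma> * d - m * k * d - r * (m * k * c) + \<sigma> * (m * ((r - b) * p + (r\<^sup>2 / 2 - b * r) * q))"
        for \<sigma> k p q c d :: real
        by (simp add: algebra_simps)
      have "v t \<bullet> ?dv = - b * sqrt m * (v t \<bullet> v t) - 1 / sqrt m * (G (x t) \<bullet> v t)"
        and "?dv \<bullet> v t = - b * sqrt m * (v t \<bullet> v t) - 1 / sqrt m * (G (x t) \<bullet> v t)"
        and "?dv \<bullet> e t = - b * sqrt m * (v t \<bullet> e t) - 1 / sqrt m * (G (x t) \<bullet> e t)"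
        and "v t \<bullet> ?de = sqrt m * (v t \<bullet> v t)" "e t \<bullet> ?de = sqrt m * (v t \<bullet> e t)"
        and "?de \<bullet> e t = sqrt m * (v t \<bullet> e t)"
        by (simp_all add: inner_diff_left inner_diff_right inner_commute)
      then show ?thesis
        using sm by (simp only: poly V'_def) (simp add: right_diff_distrib)
    qed
    ultimately show ?thesis
      by (simp add: V_def[abs_def] lyapunov_def e_def)
  qed
  have dissipation: "V' t + r * sqrt m * V t \<le> 0" if "0 \<le> t" for t
  proof -
    let ?q = "(3 * r / 2 - b) * (v t \<bullet> v t) + (3 * r\<^sup>2 / 2 - b * r) * (v t \<bullet> e t)
           + r / 2 * (r\<^sup>2 / 2 - 1) * (e t \<bullet> e t)"
    have "f (x t) + G (x t) \<bullet> (xs - x t) + m / 2 * (norm (xs - x t))\<^sup>2 \<le> f xs"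
      by (rule strongly_convex_gradient_bound[OF sc G])
    moreover have "xs - x t = - e t"
      by (simp add: e_def)
    ultimately have "f (x t) - f xs - G (x t) \<bullet> e t + m / 2 * (e t \<bullet> e t) \<le> 0"
      by (simp add: power2_norm_eq_inner)
    then have "r * (f (x t) - f xs - G (x t) \<bullet> e t + m / 2 * (e t \<bullet> e t)) \<le> 0"
      using r by (simp add: mult_nonneg_nonpos)
    moreover have "m * ?q \<le> 0"
      using m dissipation_nonpos[OF r] by (intro mult_nonneg_nonpos) auto
    ultimately have "sqrt m * (r * (f (x t) - f xs - G (x t) \<bullet> e t + m / 2 * (e t \<bullet> e t)) + m * ?q) \<le> 0"
      using m by (intro mult_nonneg_nonpos) auto
    also have "sqrt m * (r * (f (x t) - f xs - G (x t) \<bullet> e t + m / 2 * (e t \<bullet> e t)) + m * ?q)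
        = V' t + r * sqrt m * V t"
    proof -
      have "\<sigma> * (r * (F - g + m / 2 * d) + m * ((3 * r / 2 - b) * p + (3 * r\<^sup>2 / 2 - b * r) * q
              + r / 2 * (r\<^sup>2 / 2 - 1) * d))
          = \<sigma> * (m * ((r - b) * p + (r\<^sup>2 / 2 - b * r) * q) - r * g)
              + r * \<sigma> * (F + m / 2 * (p + 2 * r * q + r\<^sup>2 / 2 * d))"
        for \<sigma> F g p q d :: real
        by (simp add: power2_eq_square field_simps)
      then show ?thesis
        by (simp only: V_def V'_def lyapunov_def e_def)
    qed
    finally show ?thesis .
  qed
  have dW: "(W has_real_derivative exp (r * sqrt m * t) * (V' t + r * sqrt m * V t)) (at t within {0..})"
    if "0 \<le> t" for t
    unfolding W_def using dV[OF that]
    by (auto intro!: derivative_eq_intros simp: algebra_simps)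
  have "W T \<le> W 0"
  proof (rule DERIV_nonpos_imp_decreasing_open[OF \<open>0 \<le> T\<close>])
    show "\<exists>y. DERIV W t :> y \<and> y \<le> 0" if "0 < t" "t < T" for t
    proof (intro exI conjI)
      have "at t within {0..} = at t"
        using that by (intro at_within_interior) auto
      then show "DERIV W t :> exp (r * sqrt m * t) * (V' t + r * sqrt m * V t)"
        using dW[of t] that by simp
      show "exp (r * sqrt m * t) * (V' t + r * sqrt m * V t) \<le> 0"
        using dissipation[of t] that by (simp add: mult_nonneg_nonpos)
    qed
    have "continuous_on {0..} W"
      by (rule DERIV_continuous_on) (rule dW, simp)
    then show "continuous_on {0..T} W"
      by (rule continuous_on_subset) auto
  qed
  then have "exp (- (r * sqrt m * T)) * W T \<le> exp (- (r * sqrt m * T)) * W 0"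
    by simp
  then show ?thesis
    by (simp add: W_def V_def mult.assoc[symmetric] exp_add[symmetric])
qed

text \<open>For small \<open>b\<close> the rate makes the first constraint an equality, for large \<open>b\<close> it is the
  smaller root of the quadratic in the second. Both give \<open>3 r\<^sup>2 \<le> 2 b r \<le> r\<^sup>2 + 4\<close>, hence
  \<open>r\<^sup>2 \<le> 2\<close>, and both inequalities are equalities only at the boundary value of \<open>b\<close>; so
  excluding that value makes \<open>r\<^sup>2 < 2\<close> strict.\<close>

lemma rbar_properties:
  assumes b: "0 < b" "b \<noteq> 3 * sqrt 2 / 2"
  defines "r \<equiv> rbar b"
  shows "0 < r" "3 * r \<le> 2 * b" "0 \<le> r\<^sup>2 - 2 * b * r + 4" "r\<^sup>2 < 2"
proof -
  have sq: "(3 * sqrt 2 / 2)\<^sup>2 = (9 / 2 :: real)"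
    by (simp add: power_divide power_mult_distrib)
  have "0 < r \<and> 3 * r \<le> 2 * b \<and> 0 \<le> r\<^sup>2 - 2 * b * r + 4 \<and> r\<^sup>2 < 2"
  proof (cases "b < 3 * sqrt 2 / 2")
    case True
    then have "b\<^sup>2 < 9 / 2"
      using b power_strict_mono[of b "3 * sqrt 2 / 2" 2] sq by simp
    moreover have rb: "r = 2 * b / 3"
      using True by (simp add: r_def rbar_def)
    have "r\<^sup>2 - 2 * b * r + 4 = 4 - 8 / 9 * b\<^sup>2" "r\<^sup>2 = 4 / 9 * b\<^sup>2"
      unfolding rb by (simp_all add: power2_eq_square)
    ultimately show ?thesis
      using b rb by linarith
  next
    case False
    then have "9 / 2 < b\<^sup>2"
      using b power_strict_mono[of "3 * sqrt 2 / 2" b 2] sq by simp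
    define s where "s = sqrt (b\<^sup>2 - 4)"
    have s: "s\<^sup>2 = b\<^sup>2 - 4" "0 \<le> s"
      using \<open>9 / 2 < b\<^sup>2\<close> by (auto simp: s_def)
    have rs: "r = b - s"
      using False by (simp add: r_def rbar_def s_def)
    have "s < b"
      using s b by (intro power2_less_imp_less[of s b]) auto
    have "(b / 3)\<^sup>2 < s\<^sup>2"
      using s \<open>9 / 2 < b\<^sup>2\<close> by (simp add: power_divide)
    then have "b / 3 < s"
      using s by (intro power2_less_imp_less[of "b / 3" s]) auto
    have root: "r\<^sup>2 - 2 * b * r + 4 = 0"
      using s by (simp add: rs power2_eq_square algebra_simps)
    have "0 < r" "3 * r < 2 * b"
      using rs \<open>s < b\<close> \<open>b / 3 < s\<close> by auto
    then have "r * (3 * r) < r * (2 * b)"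
      by (intro mult_strict_left_mono)
    then have "r\<^sup>2 < 2"
      using root by (simp add: power2_eq_square algebra_simps)
    then show ?thesis
      using root \<open>0 < r\<close> \<open>3 * r < 2 * b\<close> by simp
  qed
  then show "0 < r" "3 * r \<le> 2 * b" "0 \<le> r\<^sup>2 - 2 * b * r + 4" "r\<^sup>2 < 2"
    by auto
qed

section \<open>The least eigenvalue of the weight matrix\<close>

lemma sum_blocks:
  fixes F :: "2 \<times> 'd::finite \<Rightarrow> 'a::comm_monoid_add"
  shows "sum F UNIV = (\<Sum>j\<in>UNIV. F (1, j)) + (\<Sum>j\<in>UNIV. F (2, j))"
proof -
  have "sum F UNIV = (\<Sum>i\<in>UNIV. \<Sum>j\<in>UNIV. F (i, j))"
    by (simp add: sum.cartesian_product UNIV_Times_UNIV)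
  then show ?thesis
    by (simp add: sum_2)
qed

lemma inner_stack: "stack v x \<bullet> stack v' x' = v \<bullet> v' + x \<bullet> x'"
  by (simp add: inner_vec_def sum_blocks stack_def)

lemma stack_diff: "stack v x - stack v' x' = stack (v - v') (x - x')"
  by (simp add: stack_def vec_eq_iff)

lemma scaleR_stack: "c *\<^sub>R stack v x = stack (c *\<^sub>R v) (c *\<^sub>R x)"
  by (simp add: stack_def vec_eq_iff)

lemma exists_stack: "\<exists>v x. w = stack v x"
proof (intro exI)
  have "w $ i = stack (\<chi> j. w $ (1, j)) (\<chi> j. w $ (2, j)) $ i" for i
    using exhaust_2[of "fst i"] by (cases i) (auto simp: stack_def)
  then show "w = stack (\<chi> j. w $ (1, j)) (\<chi> j. w $ (2, j))"
    unfolding vec_eq_iff by blast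
qed

lemma stack_inject: "stack v x = stack v' x' \<longleftrightarrow> v = v' \<and> x = x'"
proof
  assume "stack v x = stack v' x'"
  then have eq: "stack v x $ i = stack v' x' $ i" for i
    by simp
  show "v = v' \<and> x = x'"
    using eq[of "(1, _)"] eq[of "(2, _)"] by (simp add: stack_def vec_eq_iff)
qed simp

lemma stack_0: "stack 0 0 = 0"
  by (simp add: stack_def vec_eq_iff)

lemma kronecker_mat_1_stack:
  fixes A :: "real^2^2" and v x :: "real^'d::finite"
  shows "kronecker A (mat 1 :: real^'d^'d) *v stack v x
           = stack (A $ 1 $ 1 *\<^sub>R v + A $ 1 $ 2 *\<^sub>R x) (A $ 2 $ 1 *\<^sub>R v + A $ 2 $ 2 *\<^sub>R x)"
proof -
  have "(kronecker A (mat 1 :: real^'d^'d) *v stack v x) $ (i, k)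
      = A $ i $ 1 * v $ k + A $ i $ 2 * x $ k" for i k
    by (simp add: matrix_vector_mult_def kronecker_def sum_blocks stack_def mat_def
        if_distrib[where f = "\<lambda>y. _ * y"] if_distrib[where f = "\<lambda>y. y * _"] cong: if_cong)
  moreover have "i = 1 \<or> i = 2" for i :: 2
    by (rule exhaust_2)
  ultimately show ?thesis
    by (auto simp: vec_eq_iff stack_def)
qed

lemma Ptilde_stack:
  "Ptilde m r *v stack v x
     = (m / 2) *\<^sub>R stack (v + r *\<^sub>R x) (r *\<^sub>R v + (r\<^sup>2 / 2 + 1) *\<^sub>R x)"
  by (simp add: Ptilde_def kronecker_mat_1_stack scaleR_stack scaleR_add_right)

lemma sq_norm_wrt_Ptilde_stack:
  "sq_norm_wrt (Ptilde m r) (stack v x)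
     = m / 2 * (v \<bullet> v + 2 * r * (v \<bullet> x) + (r\<^sup>2 / 2 + 1) * (x \<bullet> x))"
  by (simp add: sq_norm_wrt_def Ptilde_stack inner_stack inner_add_right inner_commute algebra_simps)

text \<open>Subtracting the claimed eigenvalue times \<open>|w|\<^sup>2\<close> leaves a degenerate form, which is a
  nonnegative multiple of the square of \<open>u = x + ((s - r) / 4) v\<close> with
  \<open>s = sqrt (r\<^sup>2 + 16)\<close>; the identity behind this is \<open>(s + r) (s - r) = 16\<close>.\<close>

lemma sq_norm_wrt_Ptilde_ge:
  assumes "0 < m" "0 < r"
  shows "m * (r\<^sup>2 + 4 - r * sqrt (r\<^sup>2 + 16)) / 8 * (w \<bullet> w) \<le> sq_norm_wrt (Ptilde m r) w"
proof -
  define s where "s = sqrt (r\<^sup>2 + 16)"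
  have s: "s\<^sup>2 = r\<^sup>2 + 16" "0 \<le> s"
    by (auto simp: s_def)
  obtain v x where w: "w = stack v x"
    using exists_stack by blast
  define u where "u = x + ((s - r) / 4) *\<^sub>R v"
  have u: "u \<bullet> u = x \<bullet> x + (s - r) / 2 * (v \<bullet> x) + ((s - r) / 4)\<^sup>2 * (v \<bullet> v)"
    by (simp add: u_def inner_add_left inner_add_right inner_commute power2_eq_square)
  have "sq_norm_wrt (Ptilde m r) w - m * (r\<^sup>2 + 4 - r * s) / 8 * (w \<bullet> w)
      = m * r * (s + r) / 8 * (u \<bullet> u)"
  proof -
    have 1: "(s + r) * (s - r) = 16"
      using s by (simp add: power2_eq_square algebra_simps)
    have "(s + r) * (u \<bullet> u) = (s + r) * (x \<bullet> x) + (s + r) * (s - r) / 2 * (v \<bullet> x)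
        + (s + r) * (s - r) * (s - r) / 16 * (v \<bullet> v)"
      unfolding u by (simp add: power2_eq_square algebra_simps)
    also have "\<dots> = (s + r) * (x \<bullet> x) + 8 * (v \<bullet> x) + (s - r) * (v \<bullet> v)"
      unfolding 1 by simp
    finally have "m * r / 8 * ((s + r) * (u \<bullet> u))
        = m * r / 8 * ((s + r) * (x \<bullet> x) + 8 * (v \<bullet> x) + (s - r) * (v \<bullet> v))"
      by simp
    then show ?thesis
      by (simp add: w sq_norm_wrt_Ptilde_stack inner_stack power2_eq_square field_simps)
  qed
  moreover have "0 \<le> m * r * (s + r) / 8 * (u \<bullet> u)"
    using assms s by simp
  ultimately show ?thesis
    by (simp add: s_def)
qed

text \<open>The bound above is attained where \<open>u\<close> vanishes, that is for \<open>x = c v\<close> with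
  \<open>c = (r - s) / 4\<close>. Such vectors are eigenvectors since \<open>c\<close> is a root of
  \<open>c\<^sup>2 = 1 + r c / 2\<close>, and every eigenvalue is a Rayleigh quotient and so obeys the
  bound.\<close>

lemma lambda_min_Ptilde:
  assumes "0 < m" "0 < r"
  shows "lambda_min (Ptilde m r :: real^(2 \<times> 'd::finite)^(2 \<times> 'd))
           = m * (r\<^sup>2 + 4 - r * sqrt (r\<^sup>2 + 16)) / 8"
  unfolding lambda_min_def
proof (rule Least_equality)
  let ?P = "Ptilde m r :: real^(2 \<times> 'd)^(2 \<times> 'd)"
  let ?l = "m * (r\<^sup>2 + 4 - r * sqrt (r\<^sup>2 + 16)) / 8"
  define s where "s = sqrt (r\<^sup>2 + 16)"
  define c where "c = (r - s) / 4"
  have s: "s\<^sup>2 = r\<^sup>2 + 16"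
    by (simp add: s_def)
  have l: "?l = m / 2 * (1 + r * c)"
    unfolding s_def[symmetric] by (simp add: c_def power2_eq_square field_simps)
  have "c\<^sup>2 = 1 + r * c / 2"
    using s by (simp add: c_def power2_eq_square field_simps)
  then have "r * c\<^sup>2 = r * (1 + r * c / 2)"
    by simp
  then have c: "r + (r\<^sup>2 / 2 + 1) * c = (1 + r * c) * c"
    by (simp add: power2_eq_square algebra_simps)
  let ?w = "stack 1 (c *\<^sub>R 1) :: real^(2 \<times> 'd)"
  have "?P *v ?w = ?l *\<^sub>R ?w"
    unfolding l Ptilde_stack scaleR_stack stack_inject
    using c by (simp add: vec_eq_iff mult.assoc)
  moreover have "?w \<noteq> 0"
    by (simp add: stack_inject flip: stack_0)
  ultimately show "\<exists>w. w \<noteq> 0 \<and> ?P *v w = ?l *\<^sub>R w"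
    by blast
next
  fix \<mu>
  assume "\<exists>w :: real^(2 \<times> 'd). w \<noteq> 0 \<and> Ptilde m r *v w = \<mu> *\<^sub>R w"
  then obtain w :: "real^(2 \<times> 'd)" where w: "w \<noteq> 0" "Ptilde m r *v w = \<mu> *\<^sub>R w"
    by blast
  then have "sq_norm_wrt (Ptilde m r) w = \<mu> * (w \<bullet> w)"
    by (simp add: sq_norm_wrt_def)
  with sq_norm_wrt_Ptilde_ge[OF assms, of w] w
  show "m * (r\<^sup>2 + 4 - r * sqrt (r\<^sup>2 + 16)) / 8 \<le> \<mu>"
    by (auto simp: mult_le_cancel_right)
qed

lemma lambda_min_Ptilde_pos:
  assumes "0 < m" "0 < r" "r\<^sup>2 < 2"
  shows "0 < lambda_min (Ptilde m r :: real^(2 \<times> 'd::finite)^(2 \<times> 'd))"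
proof -
  have "(r * sqrt (r\<^sup>2 + 16))\<^sup>2 < (r\<^sup>2 + 4)\<^sup>2"
    using assms(3) by (simp add: power_mult_distrib) (simp add: power2_eq_square algebra_simps)
  then have "r * sqrt (r\<^sup>2 + 16) < r\<^sup>2 + 4"
    by (rule power2_less_imp_less) simp
  then show ?thesis
    using assms by (simp add: lambda_min_Ptilde)
qed

theorem theorem3p1:
  fixes m L b :: real
    and f :: "real^'d \<Rightarrow> real"
    and xs v0 x0 :: "real^'d"
    and v x :: "real \<Rightarrow> real^'d"
  assumes "0 < m" and "m < L" and "0 < b" and "b \<noteq> 3 * sqrt 2 / 2"
    and f: "f \<in> strongly_convex_smooth m L"
    and xs_minimizer: "\<And>y. f xs \<le> f y"
    and v_ode: "\<And>t. 0 \<le> t \<Longrightarrow>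
      (v has_vector_derivative
         (- (b * sqrt m)) *\<^sub>R v t - (1 / sqrt m) *\<^sub>R grad f (x t)) (at t within {0..})"
    and x_ode: "\<And>t. 0 \<le> t \<Longrightarrow>
      (x has_vector_derivative sqrt m *\<^sub>R v t) (at t within {0..})"
    and init: "stack (v 0) (x 0) = stack v0 x0"
  shows "let r = rbar b;
             P = Ptilde m r :: real^(2 \<times> 'd)^(2 \<times> 'd);
             C = 1 / lambda_min P;
             \<xi>0 = stack v0 x0;
             \<xi>s = stack 0 xs
         in C = 8 / (m * (r\<^sup>2 + 4 - r * sqrt (r\<^sup>2 + 16))) \<and>
            (\<forall>t\<ge>0. (norm (x t - xs))\<^sup>2
               \<le> C * exp (- r * sqrt m * t) * (f x0 - f xs + sq_norm_wrt P (\<xi>0 - \<xi>s)))"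
proof -
  define r where "r = rbar b"
  define P where "P = (Ptilde m r :: real^(2 \<times> 'd)^(2 \<times> 'd))"
  note r = rbar_properties[OF \<open>0 < b\<close> \<open>b \<noteq> 3 * sqrt 2 / 2\<close>, folded r_def]
  have sc: "strongly_convex m f" and G: "GDERIV f y :> grad f y" for y
    using f by (auto simp: strongly_convex_smooth_def intro: GDERIV_grad)
  have init': "v 0 = v0" "x 0 = x0"
    using init by (simp_all add: stack_inject)
  have l: "lambda_min P = m * (r\<^sup>2 + 4 - r * sqrt (r\<^sup>2 + 16)) / 8" "0 < lambda_min P"
    unfolding P_def
    by (rule lambda_min_Ptilde[OF \<open>0 < m\<close> r(1)], rule lambda_min_Ptilde_pos[OF \<open>0 < m\<close> r(1,4)])
  have C: "1 / lambda_min P = 8 / (m * (r\<^sup>2 + 4 - r * sqrt (r\<^sup>2 + 16)))"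
    by (simp add: l)
  have "(norm (x t - xs))\<^sup>2
      \<le> 1 / lambda_min P * exp (- r * sqrt m * t)
         * (f x0 - f xs + sq_norm_wrt P (stack v0 x0 - stack 0 xs))" if "0 \<le> t" for t
  proof -
    let ?V = "lyapunov m r f xs"
    let ?e = "x t - xs"
    \<comment> \<open>The last summand is the gap between the quadratic part of the Lyapunov function and the
        weighted norm.\<close>
    have weight: "sq_norm_wrt P (stack u (y - xs))
        = ?V u y - (f y - f xs) + m / 2 * (norm (y - xs))\<^sup>2" for u y
      by (simp add: P_def sq_norm_wrt_Ptilde_stack lyapunov_def power2_norm_eq_inner algebra_simps)
    have "(norm ?e)\<^sup>2 \<le> stack (v t) ?e \<bullet> stack (v t) ?e"
      by (simp add: inner_stack power2_norm_eq_inner)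
    then have "lambda_min P * (norm ?e)\<^sup>2 \<le> lambda_min P * (stack (v t) ?e \<bullet> stack (v t) ?e)"
      using l(2) by (intro mult_left_mono) auto
    also have "\<dots> \<le> sq_norm_wrt P (stack (v t) ?e)"
      unfolding l(1) unfolding P_def by (rule sq_norm_wrt_Ptilde_ge[OF \<open>0 < m\<close> r(1)])
    also have "\<dots> \<le> ?V (v t) (x t)"
      using strongly_convex_quadratic_growth[OF sc G xs_minimizer, of "x t"] by (simp add: weight)
    also have "\<dots> \<le> exp (- r * sqrt m * t) * ?V v0 x0"
      using lyapunov_decay[OF \<open>0 < m\<close> less_imp_le[OF r(1)] r(2,3) sc G v_ode x_ode that, of xs]
      by (simp add: init')
    also have "\<dots> \<le> exp (- r * sqrt m * t) * (f x0 - f xs + sq_norm_wrt P (stack v0 x0 - stack 0 xs))"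
      using \<open>0 < m\<close> by (simp add: stack_diff weight)
    finally show ?thesis
      using l(2) by (simp add: field_simps)
  qed
  with C show ?thesis
    unfolding Let_def r_def P_def by blast
qed

end
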